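(* Let $\alpha\in(0,0.5)$, $k\in\mathbb N$, and let $r=\mathrm{poly}(k)$, i.e. $r=k^c$ for a constant $c\ge1$. Then there exists a $(k+2^r)\times r$ matrix $A$ such that $$\min_{\operatorname{rank}(\hat A)\le k}\|A-\hat A\|_{\infty,\infty}\le1$$ and for any $S\subseteq[r]$ with $|S|\le r/2$, $$\min_{X\in\mathbb R^{S\times r}}\|A-A|^S X\|_{\infty,\infty}\ge\Omega(k^{0.5-\alpha}).$$
   Context: $\|M\|_{\infty,\infty}=\max_{i,j}|M_{i,j}|$. $A|^S$ is the matrix formed by the columns of $A$ indexed by $S$; $\mathbb R^{S\times r}$ denotes matrices with rows indexed by $S$ and columns indexed by $[r]$. The constant hidden in $\Omega(\cdot)$ may depend on $\alpha$ and $c$ but not on $k$. *)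

theory Defs
  imports
    "HOL-Analysis.Analysis"
    "Jordan_Normal_Form.DL_Rank"
    "Jordan_Normal_Form.DL_Submatrix"
begin

(* Meaningful only for matrices with at least one row and one column. *)
definition max_entry_norm :: "real mat \<Rightarrow> real" where
  "max_entry_norm M = Max {\<bar>M $$ (i, j)\<bar> | i j. i < dim_row M \<and> j < dim_col M}"

(* Columns are numbered from 0.  The selected columns keep their order, so the
   coefficient matrices indexed by S in the rows become those with card S rows,
   row t belonging to the t-th smallest element of S. *)
definition column_submatrix :: "real mat \<Rightarrow> nat set \<Rightarrow> real mat" where
  "column_submatrix A S = submatrix A UNIV S"

end

theory Submission
  imports Defs "HOL-Real_Asymp.Real_Asymp"
begin

text \<open>Stack a \<open>k \<times> r\<close> matrix \<open>G\<close> on top of all \<open>2 ^ r\<close> sign vectors. Every matrix of rank less than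
  \<open>r\<close> has error at least 1 on the sign rows, so \<open>G\<close> on top of zeros is an optimal approximation of
  rank at most \<open>k\<close> when \<open>k < r\<close>. If column \<open>j\<close> is approximated by columns in \<open>S\<close>, where \<open>j \<notin> S\<close>, with
  coefficients \<open>x\<close>, then some sign row turns the error into one plus the l1-norm of \<open>x\<close>, so cheap
  approximations have small coefficients. The columns of \<open>G\<close> are chosen so that small coefficients
  cannot approximate one column by others: they are (scaled) graph indicators of functions from
  \<open>{..<q}\<close> to itself, \<open>q = \<lfloor>sqrt k\<rfloor>\<close>, any two of which agree in fewer than \<open>t = \<lfloor>k powr \<alpha>\<rfloor>\<close> places.
  A greedy packing yields at least \<open>t!\<close> such functions, which eventually exceeds \<open>k powr c\<close>.\<close>

unbundle no vec_syntax

section \<open>Rank bounds and kernel vectors\<close>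

text \<open>Each possibly nonzero row, peeled off as an outer product \<open>R\<close>, costs at
  most 1 in rank, and rank is subadditive. This bounds the rank of \<open>G\<close> on top of
  zeros.\<close>

lemma (in vec_space) rank_le_if_rows_zero:
  assumes "A \<in> carrier_mat n nc"
    and "\<And>i j. i < n \<Longrightarrow> j < nc \<Longrightarrow> m \<le> i \<Longrightarrow> A $$ (i, j) = 0"
  shows "rank A \<le> m"
  using assms
proof (induction m arbitrary: A)
  case 0
  then have "A = 0\<^sub>m n nc" by (intro eq_matI) auto
  then show ?case by (simp add: rank_0I)
next
  case (Suc m)
  define B where "B = mat n nc (\<lambda>(i, j). if i = m then 0 else A $$ (i, j))"
  define R where "R = mat n nc (\<lambda>(i, j). (if i = m then 1 else 0) * A $$ (m, j))"
  have A: "A = B + R"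
    using Suc.prems(1) by (intro eq_matI) (auto simp: B_def R_def)
  have "rank B \<le> m"
    using Suc.prems(2) by (intro Suc.IH) (auto simp: B_def)
  moreover have "rank R \<le> 1"
    by (rule rank_le_1_product_entries[of R nc "\<lambda>i. if i = m then 1 else 0" "\<lambda>j. A $$ (m, j)"])
      (auto simp: R_def)
  ultimately show ?case
    using rank_subadditive[of B nc R] unfolding A by (simp add: B_def R_def)
qed

text \<open>Linear dependence is a property of the set of columns and cannot see repetitions. So
  distinct columns yield a dependence, while two equal columns yield the difference of two unit
  vectors.\<close>

lemma (in vec_space) rank_less_imp_kernel:
  assumes A: "A \<in> carrier_mat n nc" and "rank A < nc"
  obtains v where "v \<in> carrier_vec nc" "v \<noteq> 0\<^sub>v nc" "A *\<^sub>v v = 0\<^sub>v n"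
proof (cases "distinct (cols A)")
  case True
  then have "lin_dep (set (cols A))"
    using lin_indpt_full_rank[OF A] assms(2) by auto
  then show thesis
    using lin_depE[OF A _ True] that by metis
next
  case False
  then obtain i j where ij: "i < nc" "j < nc" "i \<noteq> j" "col A i = col A j"
    using A by (auto simp: distinct_conv_nth)
  define v where "v = (unit_vec nc i - unit_vec nc j :: 'a vec)"
  show thesis
  proof (rule that)
    show v: "v \<in> carrier_vec nc" by (simp add: v_def)
    have "v $ i = 1" using ij by (simp add: v_def)
    then show "v \<noteq> 0\<^sub>v nc" using ij by auto
    have "A *\<^sub>v v = A *\<^sub>v unit_vec nc i - A *\<^sub>v unit_vec nc j"
      unfolding v_def by (intro mult_minus_distrib_mat_vec[OF A]) auto
    moreover have "A *\<^sub>v unit_vec nc l = col A l" if "l < nc" for l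
      using A that by (intro eq_vecI) auto
    ultimately show "A *\<^sub>v v = 0\<^sub>v n"
      using A ij by simp
  qed
qed

section \<open>The entrywise maximum norm and existence of best approximations\<close>

lemma max_entry_norm_eq:
  "max_entry_norm M = Max ((\<lambda>(i, j). \<bar>M $$ (i, j)\<bar>) ` ({..<dim_row M} \<times> {..<dim_col M}))"
  unfolding max_entry_norm_def by (rule arg_cong[where f = Max]) auto

lemma entry_le_max_entry_norm:
  "i < dim_row M \<Longrightarrow> j < dim_col M \<Longrightarrow> \<bar>M $$ (i, j)\<bar> \<le> max_entry_norm M"
  unfolding max_entry_norm_eq by (rule Max_ge) force+

lemma max_entry_norm_le:
  assumes "0 < dim_row M" "0 < dim_col M"
    and "\<And>i j. i < dim_row M \<Longrightarrow> j < dim_col M \<Longrightarrow> \<bar>M $$ (i, j)\<bar> \<le> b"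
  shows "max_entry_norm M \<le> b"
  using assms unfolding max_entry_norm_eq by (subst Max_le_iff) auto

lemma continuous_on_Max_image:
  fixes f :: "'a \<Rightarrow> 'b :: topological_space \<Rightarrow> 'c :: linorder_topology"
  assumes "finite I" "I \<noteq> {}" "\<And>i. i \<in> I \<Longrightarrow> continuous_on S (f i)"
  shows "continuous_on S (\<lambda>x. Max ((\<lambda>i. f i x) ` I))"
  using assms
proof (induction I rule: finite_ne_induct)
  case (insert i I)
  then show ?case by (simp add: continuous_on_max)
qed simp

lemma index_minus_mult:
  fixes A B X :: "real mat"
  assumes "A \<in> carrier_mat m r" "B \<in> carrier_mat m s" "X \<in> carrier_mat s r" "i < m" "j < r"
  shows "(A - B * X) $$ (i, j) = A $$ (i, j) - (\<Sum>l<s. B $$ (i, l) * X $$ (l, j))"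
  using assms by (simp add: scalar_prod_def lessThan_atLeast0)

text \<open>Coercivity of \<open>B\<close> confines the competitors to a box, which is compact in the product
  topology on functions.\<close>

lemma ex_best_max_entry_approximation:
  fixes A B :: "real mat"
  assumes A: "A \<in> carrier_mat m r" and B: "B \<in> carrier_mat m s" and "0 < m" "0 < r"
    and coercive: "\<And>x :: nat \<Rightarrow> real. \<exists>i<m. (\<Sum>l<s. \<bar>x l\<bar>) \<le> \<bar>\<Sum>l<s. B $$ (i, l) * x l\<bar>"
  shows "\<exists>X. is_arg_min (\<lambda>X. max_entry_norm (A - B * X)) (\<lambda>X. X \<in> carrier_mat s r) X"
proof -
  define f where "f y = max_entry_norm (A - B * mat s r y)" for y :: "nat \<times> nat \<Rightarrow> real"
  define N where "N = max_entry_norm A"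
  \<comment> \<open>A coefficient above \<open>2 * N\<close> makes some entry of
    \<open>B * X\<close> exceed \<open>2 * N\<close>, while entries of \<open>A\<close> are at most
    \<open>N\<close>; the error is then at least \<open>N\<close>, which zero coefficients attain.
    Coordinates outside the matrix are pinned to 0, so the product over all index pairs is still
    compact.\<close>
  define box where "box p = (if p \<in> {..<s} \<times> {..<r} then {-2 * N..2 * N} else {0})" for p :: "nat \<times> nat"
  define K where "K = Pi\<^sub>E UNIV box"
  have N0: "0 \<le> N"
    using entry_le_max_entry_norm[of 0 A 0] A \<open>0 < m\<close> \<open>0 < r\<close> unfolding N_def by auto
  have "compactin (product_topology (\<lambda>_. euclidean) UNIV) K"
    unfolding K_def by (subst compactin_PiE) (auto simp: box_def)
  then have "compact K"
    by (simp add: euclidean_product_topology)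
  moreover have zero: "(\<lambda>_. 0) \<in> K"
    using N0 by (auto simp: K_def box_def)
  moreover have "continuous_on K f"
  proof -
    have f: "f y = Max ((\<lambda>p. \<bar>A $$ p - (\<Sum>l<s. B $$ (fst p, l) * y (l, snd p))\<bar>) ` ({..<m} \<times> {..<r}))" for y
      unfolding f_def max_entry_norm_eq using A B
      by (intro arg_cong[where f = Max] image_cong) (auto simp: index_minus_mult[OF A B])
    show ?thesis
      unfolding f using \<open>0 < m\<close> \<open>0 < r\<close>
      by (intro continuous_on_Max_image continuous_intros
          continuous_on_subset[OF continuous_on_product_coordinates]) auto
  qed
  ultimately obtain y where y: "y \<in> K" "\<And>z. z \<in> K \<Longrightarrow> f y \<le> f z"
    using continuous_attains_inf[of K f] by blast
  have "f y \<le> max_entry_norm (A - B * X)" if X: "X \<in> carrier_mat s r" for X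
  proof (cases "\<forall>l<s. \<forall>j<r. \<bar>X $$ (l, j)\<bar> \<le> 2 * N")
    case True
    define z where "z p = (if p \<in> {..<s} \<times> {..<r} then X $$ p else 0)" for p
    have "z \<in> K"
      using True by (force simp: K_def box_def z_def abs_le_iff)
    moreover have "mat s r z = X"
      using X by (intro eq_matI) (auto simp: z_def)
    ultimately show ?thesis using y(2)[of z] by (simp add: f_def)
  next
    case False
    then obtain l j where lj: "l < s" "j < r" "2 * N < \<bar>X $$ (l, j)\<bar>" by force
    obtain i where i: "i < m" "(\<Sum>l<s. \<bar>X $$ (l, j)\<bar>) \<le> \<bar>\<Sum>l<s. B $$ (i, l) * X $$ (l, j)\<bar>"
      using coercive[of "\<lambda>l. X $$ (l, j)"] by blast
    have "\<bar>X $$ (l, j)\<bar> \<le> (\<Sum>l<s. \<bar>X $$ (l, j)\<bar>)"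
      using lj by (intro member_le_sum) auto
    moreover have "\<bar>A $$ (i, j)\<bar> \<le> N"
      unfolding N_def using A i lj by (intro entry_le_max_entry_norm) auto
    moreover have "\<bar>(A - B * X) $$ (i, j)\<bar> \<le> max_entry_norm (A - B * X)"
      using A B X i lj by (intro entry_le_max_entry_norm) auto
    ultimately have "N \<le> max_entry_norm (A - B * X)"
      using lj i index_minus_mult[OF A B X i(1) lj(2)] by linarith
    moreover have "f (\<lambda>_. 0) = N"
    proof -
      have "A - B * mat s r (\<lambda>_. 0) = A"
        using A B by (intro eq_matI) (auto simp: index_minus_mult[OF A B] scalar_prod_def)
      then show ?thesis by (simp add: f_def N_def)
    qed
    ultimately show ?thesis using y(2)[OF zero] by linarith
  qed
  then show ?thesis
    unfolding is_arg_min_linorder f_def by (intro exI[of _ "mat s r y"]) auto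
qed

section \<open>Entries of column submatrices\<close>

lemma
  assumes "S \<subseteq> {..<dim_col A}"
  shows dim_row_column_submatrix: "dim_row (column_submatrix A S) = dim_row A"
    and dim_col_column_submatrix: "dim_col (column_submatrix A S) = card S"
    and index_column_submatrix: "i < dim_row A \<Longrightarrow> l < card S \<Longrightarrow>
      column_submatrix A S $$ (i, l) = A $$ (i, pick S l)"
proof -
  have [simp]: "{j. j < dim_col A \<and> j \<in> S} = S" using assms by auto
  show "dim_row (column_submatrix A S) = dim_row A"
    and "dim_col (column_submatrix A S) = card S"
    by (simp_all add: column_submatrix_def dim_submatrix)
  show "column_submatrix A S $$ (i, l) = A $$ (i, pick S l)" if "i < dim_row A" "l < card S"
    using that by (simp add: column_submatrix_def submatrix_index pick_UNIV)
qed

lemma inj_on_pick: "inj_on (pick S) {..<card S}"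
  by (rule linorder_inj_onI) (auto dest: pick_mono_le)

section \<open>Sign rows and optimal low-rank approximation\<close>

text \<open>The lower rows are numbered by binary codes of subsets of the columns, so each of the
  \<open>2 ^ r\<close> sign patterns occurs exactly once.\<close>

definition sign_stack :: "nat \<Rightarrow> nat \<Rightarrow> (nat \<Rightarrow> nat \<Rightarrow> real) \<Rightarrow> real mat" where
  "sign_stack k r G = mat (k + 2 ^ r) r
     (\<lambda>(i, j). if i < k then G i j else if j \<in> set_decode (i - k) then 1 else -1)"

lemma sign_stack_carrier [simp]: "sign_stack k r G \<in> carrier_mat (k + 2 ^ r) r"
  by (simp add: sign_stack_def)

lemma sign_stack_dim [simp]:
  "dim_row (sign_stack k r G) = k + 2 ^ r" "dim_col (sign_stack k r G) = r"
  by (simp_all add: sign_stack_def)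

lemma sign_stack_top: "i < k \<Longrightarrow> j < r \<Longrightarrow> sign_stack k r G $$ (i, j) = G i j"
  by (simp add: sign_stack_def)

lemma sign_stack_row:
  assumes "P \<subseteq> {..<r}"
  obtains i where "i < k + 2 ^ r"
    "\<And>j. j < r \<Longrightarrow> sign_stack k r G $$ (i, j) = (if j \<in> P then 1 else -1)"
proof
  have P: "finite P" using assms finite_subset by blast
  have "set_encode P \<le> (\<Sum>j<r. 2 ^ j)"
    unfolding set_encode_def using assms by (intro sum_mono2) auto
  also have "\<dots> < 2 ^ r" by (induction r) auto
  finally show less: "k + set_encode P < k + 2 ^ r" by simp
  show "sign_stack k r G $$ (k + set_encode P, j) = (if j \<in> P then 1 else -1)" if "j < r" for j
    using that less P by (simp add: sign_stack_def)
qed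

text \<open>A nonzero kernel vector \<open>v\<close> of \<open>B\<close> cannot exist if some row of \<open>B\<close> has the sign pattern of
  \<open>v\<close>, and an error below 1 would force such a row.\<close>

lemma sign_stack_error_ge_1:
  assumes B: "B \<in> carrier_mat (k + 2 ^ r) r" and "vec_space.rank (k + 2 ^ r) B < r"
  shows "1 \<le> max_entry_norm (sign_stack k r G - B)"
proof (rule ccontr)
  assume small: "\<not> ?thesis"
  obtain v where v: "v \<in> carrier_vec r" "v \<noteq> 0\<^sub>v r" "B *\<^sub>v v = 0\<^sub>v (k + 2 ^ r)"
    using vec_space.rank_less_imp_kernel[OF assms] by blast
  obtain j where j: "j < r" "v $ j \<noteq> 0"
    using v(1,2) by (metis carrier_vecD eq_vecI index_zero_vec)
  obtain i where i: "i < k + 2 ^ r"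
    "\<And>j. j < r \<Longrightarrow> sign_stack k r G $$ (i, j) = (if j \<in> {j. j < r \<and> 0 < v $ j} then 1 else -1)"
    using sign_stack_row[of "{j. j < r \<and> 0 < v $ j}" r k G] by blast
  \<comment> \<open>An entry closer than 1 to a sign has that sign. Hence every nonzero coordinate
    of \<open>v\<close> contributes positively to row \<open>i\<close> of the product with
    \<open>v\<close>.\<close>
  have pos: "0 < B $$ (i, j) * v $ j" if "j < r" "v $ j \<noteq> 0" for j
  proof -
    have "\<bar>(sign_stack k r G - B) $$ (i, j)\<bar> < 1"
      using entry_le_max_entry_norm[of i "sign_stack k r G - B" j] small B i(1) that by auto
    then have "\<bar>(if 0 < v $ j then 1 else -1) - B $$ (i, j)\<bar> < 1"
      using B i that by simp
    then show ?thesis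
      using that(2) by (auto simp: zero_less_mult_iff split: if_splits)
  qed
  have "0 < (\<Sum>j<r. B $$ (i, j) * v $ j)"
  proof (rule sum_pos2[of _ j])
    show "0 \<le> B $$ (i, l) * v $ l" if "l \<in> {..<r}" for l
      using pos[of l] that by (cases "v $ l = 0") auto
  qed (use j pos in auto)
  also have "\<dots> = (B *\<^sub>v v) $ i"
    using B v(1) i(1) by (simp add: scalar_prod_def lessThan_atLeast0)
  finally show False using v(3) i(1) by simp
qed

lemma sign_stack_low_rank:
  assumes "0 < r" "k \<le> r"
  shows "\<exists>B. is_arg_min (\<lambda>B. max_entry_norm (sign_stack k r G - B))
             (\<lambda>B. B \<in> carrier_mat (k + 2 ^ r) r \<and> vec_space.rank (k + 2 ^ r) B \<le> k) B
           \<and> max_entry_norm (sign_stack k r G - B) \<le> 1"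
proof (cases "k = r")
  case True
  have "max_entry_norm (sign_stack k r G - sign_stack k r G) \<le> 0"
    using assms by (intro max_entry_norm_le) auto
  moreover have "0 \<le> max_entry_norm (sign_stack k r G - B)" if "B \<in> carrier_mat (k + 2 ^ r) r" for B
    using entry_le_max_entry_norm[of 0 "sign_stack k r G - B" 0] that assms by fastforce
  moreover have "vec_space.rank (k + 2 ^ r) (sign_stack k r G) \<le> k"
    using vec_space.rank_le_nc[OF sign_stack_carrier[of k r G]] True by simp
  ultimately show ?thesis
    unfolding is_arg_min_linorder by (intro exI[of _ "sign_stack k r G"]) force
next
  case False
  \<comment> \<open>\<open>B\<close> has error at most 1 and every competitor, having rank below
    \<open>r\<close>, has error at least 1; so \<open>B\<close> is a minimizer.\<close>
  define B where "B = mat (k + 2 ^ r) r (\<lambda>(i, j). if i < k then G i j else 0)"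
  have B: "B \<in> carrier_mat (k + 2 ^ r) r" by (simp add: B_def)
  have "vec_space.rank (k + 2 ^ r) B \<le> k"
    by (rule vec_space.rank_le_if_rows_zero[OF B]) (simp add: B_def)
  moreover have "max_entry_norm (sign_stack k r G - B) \<le> 1"
    using assms by (intro max_entry_norm_le) (auto simp: B_def sign_stack_def)
  moreover have "1 \<le> max_entry_norm (sign_stack k r G - M)"
    if "M \<in> carrier_mat (k + 2 ^ r) r" "vec_space.rank (k + 2 ^ r) M \<le> k" for M
    using sign_stack_error_ge_1[OF that(1)] that(2) False assms by auto
  ultimately show ?thesis
    using B unfolding is_arg_min_linorder by (intro exI[of _ B]) force
qed

section \<open>Approximation by selected columns\<close>

lemma sign_stack_select:
  assumes "S \<subseteq> {..<r}"
  shows "column_submatrix (sign_stack k r G) S \<in> carrier_mat (k + 2 ^ r) (card S)"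
    and "dim_row (column_submatrix (sign_stack k r G) S) = k + 2 ^ r"
    and "\<And>i l. i < k + 2 ^ r \<Longrightarrow> l < card S \<Longrightarrow>
      column_submatrix (sign_stack k r G) S $$ (i, l) = sign_stack k r G $$ (i, pick S l)"
proof -
  have "S \<subseteq> {..<dim_col (sign_stack k r G)}" using assms by simp
  note this [THEN dim_row_column_submatrix] this [THEN dim_col_column_submatrix]
    this [THEN index_column_submatrix]
  then show "column_submatrix (sign_stack k r G) S \<in> carrier_mat (k + 2 ^ r) (card S)"
    "dim_row (column_submatrix (sign_stack k r G) S) = k + 2 ^ r"
    "\<And>i l. i < k + 2 ^ r \<Longrightarrow> l < card S \<Longrightarrow>
      column_submatrix (sign_stack k r G) S $$ (i, l) = sign_stack k r G $$ (i, pick S l)"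
    by (auto intro: carrier_matI)
qed

lemma pick_less: "S \<subseteq> {..<r} \<Longrightarrow> l < card S \<Longrightarrow> pick S l < r"
  using pick_in_set_le by blast

text \<open>Sign patterns are prescribed at positions within \<open>S\<close>, but sign rows are
  indexed by sets of column numbers; injectivity of \<open>pick S\<close> translates between
  them.\<close>

lemma pick_mem_image_iff:
  "l < card S \<Longrightarrow> pick S l \<in> pick S ` {m. m < card S \<and> Q m} \<longleftrightarrow> Q l"
  using inj_on_image_mem_iff[OF inj_on_pick, of l S "{m. m < card S \<and> Q m}"] by auto

text \<open>Coercivity comes from the sign row that agrees with the signs of \<open>x\<close> on the
  selected columns: it returns exactly the l1-norm of \<open>x\<close>.\<close>

lemma sign_stack_ex_best:
  assumes "0 < r" "S \<subseteq> {..<r}"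
  shows "\<exists>X. is_arg_min (\<lambda>X. max_entry_norm (sign_stack k r G - column_submatrix (sign_stack k r G) S * X))
               (\<lambda>X. X \<in> carrier_mat (card S) r) X"
proof (rule ex_best_max_entry_approximation[OF sign_stack_carrier sign_stack_select(1)])
  fix x :: "nat \<Rightarrow> real"
  define P where "P = pick S ` {l. l < card S \<and> 0 \<le> x l}"
  have "P \<subseteq> {..<r}" using pick_less[OF assms(2)] by (auto simp: P_def)
  then obtain i where i: "i < k + 2 ^ r"
    "\<And>j. j < r \<Longrightarrow> sign_stack k r G $$ (i, j) = (if j \<in> P then 1 else -1)"
    using sign_stack_row[of P r k G] by blast
  have "column_submatrix (sign_stack k r G) S $$ (i, l) * x l = \<bar>x l\<bar>" if "l < card S" for l
    using that i pick_less[OF assms(2)]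
    by (simp add: sign_stack_select(3)[OF assms(2)] P_def pick_mem_image_iff)
  then show "\<exists>i<k + 2 ^ r. (\<Sum>l<card S. \<bar>x l\<bar>) \<le>
      \<bar>\<Sum>l<card S. column_submatrix (sign_stack k r G) S $$ (i, l) * x l\<bar>"
    using i(1) by (intro exI[of _ i]) simp
qed (use assms in auto)

text \<open>As \<open>j\<close> is not in \<open>S\<close>, a sign row may be +1 at \<open>j\<close>
  and opposite to the signs of the coefficients on \<open>S\<close>. Nothing cancels in that row:
  its error is one plus the l1-norm.\<close>

lemma sign_stack_column_error:
  assumes S: "S \<subseteq> {..<r}" and j: "j < r" "j \<notin> S" and X: "X \<in> carrier_mat (card S) r"
  shows "1 + (\<Sum>l<card S. \<bar>X $$ (l, j)\<bar>) \<le>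
    max_entry_norm (sign_stack k r G - column_submatrix (sign_stack k r G) S * X)"
    (is "_ \<le> max_entry_norm (?A - ?B * X)")
proof -
  define P where "P = insert j (pick S ` {l. l < card S \<and> X $$ (l, j) < 0})"
  have "P \<subseteq> {..<r}" using pick_less[OF S] j by (auto simp: P_def)
  then obtain i where i: "i < k + 2 ^ r"
    "\<And>j. j < r \<Longrightarrow> ?A $$ (i, j) = (if j \<in> P then 1 else -1)"
    using sign_stack_row[of P r k G] by blast
  have "?B $$ (i, l) * X $$ (l, j) = - \<bar>X $$ (l, j)\<bar>" if "l < card S" for l
  proof -
    have "pick S l \<noteq> j" using that j pick_in_set_le by blast
    then show ?thesis
      using that i pick_less[OF S]
      by (simp add: sign_stack_select(3)[OF S] P_def pick_mem_image_iff)
  qed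
  then have "(?A - ?B * X) $$ (i, j) = 1 + (\<Sum>l<card S. \<bar>X $$ (l, j)\<bar>)"
    using i j index_minus_mult[OF sign_stack_carrier sign_stack_select(1)[OF S] X i(1) j(1)]
    by (simp add: sum_negf P_def)
  then show ?thesis
    using entry_le_max_entry_norm[of i "?A - ?B * X" j] i(1) j(1) X by (simp add: sign_stack_select(2)[OF S])
qed

text \<open>Testing the residual of column \<open>j\<close> against \<open>g j\<close> itself: small coherence means that only
  coefficients of large total size can cancel \<open>g j\<close>.\<close>

lemma sign_stack_incoherent_error:
  fixes q t :: real and g :: "nat \<Rightarrow> nat \<Rightarrow> real"
  assumes "0 < q" "1 \<le> t"
    and l1: "\<And>j. j < r \<Longrightarrow> (\<Sum>i<k. \<bar>g j i\<bar>) = q"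
    and l2: "\<And>j. j < r \<Longrightarrow> (\<Sum>i<k. g j i * g j i) = q"
    and coherence: "\<And>j l. j < r \<Longrightarrow> l < r \<Longrightarrow> j \<noteq> l \<Longrightarrow> \<bar>\<Sum>i<k. g j i * g l i\<bar> \<le> t"
    and S: "S \<subseteq> {..<r}" and j: "j < r" "j \<notin> S" and X: "X \<in> carrier_mat (card S) r"
  shows "q / (2 * t) \<le> max_entry_norm (sign_stack k r (\<lambda>i j. q * g j i) -
    column_submatrix (sign_stack k r (\<lambda>i j. q * g j i)) S * X)"
    (is "_ \<le> max_entry_norm (?A - ?B * X)")
proof (rule ccontr)
  assume small: "\<not> ?thesis"
  define N where "N = max_entry_norm (?A - ?B * X)"
  define x where "x l = X $$ (l, j)" for l
  \<comment> \<open>In the top block the residual of column \<open>j\<close> is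
    \<open>q * h\<close>.\<close>
  define h where "h i = g j i - (\<Sum>l<card S. g (pick S l) i * x l)" for i
  have N: "N < q / (2 * t)" using small by (simp add: N_def)
  \<comment> \<open>The sign rows turn the small error into a bound on the coefficients. With
    coherence at most \<open>t\<close>, the cross terms below then total at most
    \<open>q / 2\<close>.\<close>
  have x: "(\<Sum>l<card S. \<bar>x l\<bar>) < q / (2 * t)"
    using sign_stack_column_error[OF S j X, of k "\<lambda>i j. q * g j i"] N
    unfolding N_def[symmetric] x_def by linarith
  have h: "q * \<bar>h i\<bar> \<le> N" if "i < k" for i
  proof -
    have "(?A - ?B * X) $$ (i, j) = q * g j i - (\<Sum>l<card S. q * g (pick S l) i * x l)"
      using that j(1) pick_less[OF S]
        index_minus_mult[OF sign_stack_carrier sign_stack_select(1)[OF S] X _ j(1), of i]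
      by (simp add: sign_stack_select(3)[OF S] sign_stack_top x_def)
    also have "\<dots> = q * h i"
      by (simp add: h_def right_diff_distrib sum_distrib_left mult.assoc)
    finally show ?thesis
      using entry_le_max_entry_norm[of i "?A - ?B * X" j] that j(1) X \<open>0 < q\<close>
      by (simp add: sign_stack_select(2)[OF S] N_def abs_mult)
  qed
  have "(\<Sum>i<k. g j i * h i) = q - (\<Sum>i<k. \<Sum>l<card S. x l * (g j i * g (pick S l) i))"
    using l2[OF j(1)]
    by (simp add: h_def right_diff_distrib sum_subtractf sum_distrib_left mult_ac)
  moreover have "(\<Sum>i<k. \<Sum>l<card S. x l * (g j i * g (pick S l) i)) =
      (\<Sum>l<card S. x l * (\<Sum>i<k. g j i * g (pick S l) i))"
    by (subst sum.swap) (simp add: sum_distrib_left)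
  moreover have "(\<Sum>l<card S. x l * (\<Sum>i<k. g j i * g (pick S l) i)) \<le> (\<Sum>l<card S. \<bar>x l\<bar> * t)"
  proof (rule sum_mono)
    fix l assume l: "l \<in> {..<card S}"
    then have "\<bar>\<Sum>i<k. g j i * g (pick S l) i\<bar> \<le> t"
      using coherence[of j "pick S l"] j pick_less[OF S] pick_in_set_le[of l S] by auto
    then have "\<bar>x l * (\<Sum>i<k. g j i * g (pick S l) i)\<bar> \<le> \<bar>x l\<bar> * t"
      by (simp add: abs_mult mult_left_mono)
    then show "x l * (\<Sum>i<k. g j i * g (pick S l) i) \<le> \<bar>x l\<bar> * t" by linarith
  qed
  moreover have "(\<Sum>l<card S. \<bar>x l\<bar> * t) \<le> q / 2"
    unfolding sum_distrib_right[symmetric] using x \<open>1 \<le> t\<close> by (simp add: field_simps)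
  ultimately have "q / 2 \<le> (\<Sum>i<k. g j i * h i)" by linarith
  \<comment> \<open>Upper bound for the same inner product: \<open>h\<close> is at most
    \<open>N / q\<close> entrywise and \<open>g j\<close> has l1-norm \<open>q\<close>. The scaling
    by \<open>q\<close> is what makes the result \<open>N\<close>, which is less than
    \<open>q / 2\<close>.\<close>
  also have "\<dots> \<le> (\<Sum>i<k. \<bar>g j i\<bar> * (N / q))"
  proof (rule sum_mono)
    fix i assume "i \<in> {..<k}"
    then have "\<bar>h i\<bar> \<le> N / q"
      using h[of i] \<open>0 < q\<close> by (simp add: field_simps)
    then have "\<bar>g j i * h i\<bar> \<le> \<bar>g j i\<bar> * (N / q)"
      unfolding abs_mult by (intro mult_left_mono) auto
    then show "g j i * h i \<le> \<bar>g j i\<bar> * (N / q)" by linarith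
  qed
  also have "\<dots> = N"
    unfolding sum_distrib_right[symmetric] l1[OF j(1)] using \<open>0 < q\<close> by simp
  also have "N < q / (2 * t)" by (rule N)
  also have "\<dots> \<le> q / 2"
    using \<open>0 < q\<close> \<open>1 \<le> t\<close> by (simp add: field_simps)
  finally show False by simp
qed

section \<open>Packing functions with few agreements\<close>

text \<open>Union bound: such a function agrees with \<open>f\<close> on some set \<open>T\<close>
  of exactly \<open>t\<close> points, and for fixed \<open>T\<close> only the other
  \<open>q - t\<close> values are free.\<close>

lemma card_agreeing_le:
  assumes "t \<le> q" "f \<in> {..<q} \<rightarrow>\<^sub>E {..<q}"
  shows "card {h \<in> {..<q} \<rightarrow>\<^sub>E {..<q}. t \<le> card {a. a < q \<and> f a = h a}} \<le> (q choose t) * q ^ (q - t)"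
proof -
  define ext where "ext T = Pi\<^sub>E {..<q} (\<lambda>a. if a \<in> T then {f a} else {..<q})" for T
  define \<T> where "\<T> = {T. T \<subseteq> {..<q} \<and> card T = t}"
  have "finite \<T>" by (rule finite_subset[of _ "Pow {..<q}"]) (auto simp: \<T>_def)
  have ext: "card (ext T) = q ^ (q - t)" "finite (ext T)" if "T \<in> \<T>" for T
  proof -
    have "card (ext T) = (\<Prod>a<q. if a \<in> T then 1 else q)"
      unfolding ext_def by (subst card_PiE) (auto intro!: prod.cong)
    also have "\<dots> = (\<Prod>a \<in> {..<q} - T. q)"
      by (rule prod.mono_neutral_cong_right) auto
    also have "\<dots> = q ^ (q - t)"
      using that finite_subset[of T "{..<q}"] by (simp add: \<T>_def card_Diff_subset)
    finally show "card (ext T) = q ^ (q - t)" .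
    show "finite (ext T)" unfolding ext_def by (intro finite_PiE) auto
  qed
  have "{h \<in> {..<q} \<rightarrow>\<^sub>E {..<q}. t \<le> card {a. a < q \<and> f a = h a}} \<subseteq> (\<Union>T\<in>\<T>. ext T)"
  proof safe
    fix h assume h: "h \<in> {..<q} \<rightarrow>\<^sub>E {..<q}" "t \<le> card {a. a < q \<and> f a = h a}"
    obtain T where T: "T \<subseteq> {a. a < q \<and> f a = h a}" "card T = t"
      using obtain_subset_with_card_n[OF h(2)] by metis
    have "T \<in> \<T>" using T by (auto simp: \<T>_def)
    moreover have "h \<in> ext T" using T h(1) unfolding ext_def by (auto simp: PiE_iff)
    ultimately show "h \<in> (\<Union>T\<in>\<T>. ext T)" by blast
  qed
  then have "card {h \<in> {..<q} \<rightarrow>\<^sub>E {..<q}. t \<le> card {a. a < q \<and> f a = h a}} \<le> card (\<Union>T\<in>\<T>. ext T)"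
    using \<open>finite \<T>\<close> ext by (intro card_mono) auto
  also have "\<dots> \<le> (\<Sum>T\<in>\<T>. card (ext T))"
    using \<open>finite \<T>\<close> by (rule card_UN_le)
  also have "\<dots> = (q choose t) * q ^ (q - t)"
    using ext n_subsets[of "{..<q}" t] by (simp add: \<T>_def)
  finally show ?thesis .
qed

text \<open>Gilbert--Varshamov: the agreement balls around a maximal family cover everything.\<close>

lemma ex_family_small_agreement:
  assumes "t \<le> q" "0 < q"
  obtains F where "F \<subseteq> {..<q} \<rightarrow>\<^sub>E {..<q}" "finite F" "fact t \<le> card F"
    "\<And>f h. f \<in> F \<Longrightarrow> h \<in> F \<Longrightarrow> f \<noteq> h \<Longrightarrow> card {a. a < q \<and> f a = h a} < t"
proof -
  define U where "U = ({..<q} \<rightarrow>\<^sub>E {..<q})"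
  define good where "good F \<longleftrightarrow> F \<subseteq> U \<and>
    (\<forall>f\<in>F. \<forall>h\<in>F. f \<noteq> h \<longrightarrow> card {a. a < q \<and> f a = h a} < t)" for F
  define ball where "ball f = {h \<in> U. t \<le> card {a. a < q \<and> f a = h a}}" for f
  have U: "finite U" "card U = q ^ q"
    by (auto simp: U_def card_PiE intro: finite_PiE)
  have "finite (Collect good)"
    by (rule finite_subset[of _ "Pow U"]) (use U(1) in \<open>auto simp: good_def\<close>)
  moreover have "good {}" by (simp add: good_def)
  ultimately obtain F where F: "good F" "\<And>F'. good F' \<Longrightarrow> F \<subseteq> F' \<Longrightarrow> F = F'"
    using finite_has_maximal[of "Collect good"] by (metis empty_iff mem_Collect_eq)
  have FU: "F \<subseteq> U" using F(1) by (simp add: good_def)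
  then have finF: "finite F" using U(1) finite_subset by blast
  have "U \<subseteq> (\<Union>f\<in>F. ball f)"
  proof
    fix h assume h: "h \<in> U"
    show "h \<in> (\<Union>f\<in>F. ball f)"
    proof (cases "h \<in> F")
      case True
      then show ?thesis using h \<open>t \<le> q\<close> by (intro UN_I[of h]) (auto simp: ball_def)
    next
      case False
      \<comment> \<open>By maximality \<open>h\<close> cannot be added, so it agrees too often with
        some member of \<open>F\<close>.\<close>
      then have "\<not> good (insert h F)" using F(2) by blast
      then obtain f where "f \<in> F" "t \<le> card {a. a < q \<and> f a = h a}"
        using F(1) h unfolding good_def by (auto simp: not_less eq_commute[of "h _"])
      then show ?thesis using h by (auto simp: ball_def)
    qed
  qed
  then have "q ^ q \<le> card (\<Union>f\<in>F. ball f)"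
    unfolding U(2)[symmetric] using finF U(1) by (intro card_mono) (auto simp: ball_def)
  also have "\<dots> \<le> (\<Sum>f\<in>F. card (ball f))"
    using finF by (rule card_UN_le)
  also have "\<dots> \<le> (\<Sum>f\<in>F. (q choose t) * q ^ (q - t))"
    using FU unfolding ball_def U_def by (intro sum_mono card_agreeing_le \<open>t \<le> q\<close>) auto
  \<comment> \<open>Cancelling the free values leaves q^t \<le> card F * (q choose t). Since t! * (q
    choose t) \<le> q^t, cancelling the binomial coefficient as well leaves t!.\<close>
  finally have "q ^ t * q ^ (q - t) \<le> card F * (q choose t) * q ^ (q - t)"
    using \<open>t \<le> q\<close> by (simp add: power_add[symmetric])
  then have "q ^ t \<le> card F * (q choose t)"
    using \<open>0 < q\<close> by simp
  moreover have "(q choose t) * fact t \<le> q ^ t"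
    by (rule binomial_fact_pow)
  ultimately have "(q choose t) * fact t \<le> (q choose t) * card F"
    by (metis le_trans mult.commute)
  then have "fact t \<le> card F"
    using \<open>t \<le> q\<close> by simp
  then show thesis
    using that[of F] F(1) finF by (auto simp: good_def U_def)
qed

section \<open>Incoherent vectors from function graphs\<close>

text \<open>Coordinate \<open>i\<close> encodes the grid point (\<open>i div q\<close>,
  \<open>i mod q\<close>), so the inner product counts the common points of two graphs, one for each
  agreement.\<close>

lemma sum_graph_indicators:
  fixes f h :: "nat \<Rightarrow> nat"
  assumes "q * q \<le> k" "\<And>a. a < q \<Longrightarrow> f a < q" "\<And>a. a < q \<Longrightarrow> h a < q"
  shows "(\<Sum>i<k. of_bool (i < q * q \<and> f (i div q) = i mod q) *
      of_bool (i < q * q \<and> h (i div q) = i mod q) :: real) = card {a. a < q \<and> f a = h a}"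
proof -
  define I where "I = {i. i < q * q \<and> f (i div q) = i mod q \<and> h (i div q) = i mod q}"
  have "bij_betw (\<lambda>i. i div q) I {a. a < q \<and> f a = h a}"
  proof (rule bij_betwI[where g = "\<lambda>a. a * q + f a"])
    show "(\<lambda>i. i div q) \<in> I \<rightarrow> {a. a < q \<and> f a = h a}"
      by (auto simp: I_def less_mult_imp_div_less)
    show "(\<lambda>a. a * q + f a) \<in> {a. a < q \<and> f a = h a} \<rightarrow> I"
    proof
      fix a assume a: "a \<in> {a. a < q \<and> f a = h a}"
      then have "f a < q" using assms by auto
      have "a * q + f a < Suc a * q" using \<open>f a < q\<close> by simp
      also have "\<dots> \<le> q * q" using a by (intro mult_le_mono1) auto
      finally show "a * q + f a \<in> I" using a \<open>f a < q\<close> by (auto simp: I_def)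
    qed
    show "i div q * q + f (i div q) = i" if "i \<in> I" for i
      using that by (simp add: I_def)
    show "(a * q + f a) div q = a" if "a \<in> {a. a < q \<and> f a = h a}" for a
      using that assms(2)[of a] by simp
  qed
  then have "card I = card {a. a < q \<and> f a = h a}" by (rule bij_betw_same_card)
  moreover have "{..<k} \<inter> {i. (i < q * q \<and> f (i div q) = i mod q) \<and> i < q * q \<and> h (i div q) = i mod q} = I"
    using assms(1) by (auto simp: I_def)
  ultimately show ?thesis
    by (simp add: sum_of_bool_eq flip: of_bool_conj)
qed

lemma ex_incoherent_vectors:
  assumes "1 \<le> t" "t \<le> q" "q * q \<le> k" "r \<le> fact t"
  shows "\<exists>g :: nat \<Rightarrow> nat \<Rightarrow> real.
    (\<forall>j<r. (\<Sum>i<k. \<bar>g j i\<bar>) = real q) \<and> (\<forall>j<r. (\<Sum>i<k. g j i * g j i) = real q) \<and>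
    (\<forall>j<r. \<forall>l<r. j \<noteq> l \<longrightarrow> \<bar>\<Sum>i<k. g j i * g l i\<bar> \<le> real t)"
proof -
  obtain F where F: "F \<subseteq> {..<q} \<rightarrow>\<^sub>E {..<q}" "finite F" "fact t \<le> card F"
    "\<And>f h. f \<in> F \<Longrightarrow> h \<in> F \<Longrightarrow> f \<noteq> h \<Longrightarrow> card {a. a < q \<and> f a = h a} < t"
    using ex_family_small_agreement[of t q] assms by auto
  have "card {..<r} \<le> card F" using F(3) assms(4) by simp
  then obtain e where e: "e ` {..<r} \<subseteq> F" "inj_on e {..<r}"
    using card_le_inj[of "{..<r}" F] F(2) by auto
  have range: "e j a < q" if "j < r" "a < q" for j a
    using that e(1) F(1) by (auto simp: PiE_iff image_subset_iff subset_iff)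
  define g :: "nat \<Rightarrow> nat \<Rightarrow> real"
    where "g j i = of_bool (i < q * q \<and> e j (i div q) = i mod q)" for j i
  have inner: "(\<Sum>i<k. g j i * g l i) = card {a. a < q \<and> e j a = e l a}" if "j < r" "l < r" for j l
    unfolding g_def using that range by (intro sum_graph_indicators assms(3)) auto
  have self: "(\<Sum>i<k. g j i * g j i) = q" if "j < r" for j
    using inner[OF that that] by simp
  \<comment> \<open>For 0/1 vectors the l1-norm equals the squared l2-norm; both count the
    \<open>q\<close> points of the graph.\<close>
  moreover have "\<bar>g j i\<bar> = g j i * g j i" for j i by (simp add: g_def)
  moreover have "\<bar>\<Sum>i<k. g j i * g l i\<bar> \<le> real t" if "j < r" "l < r" "j \<noteq> l" for j l
  proof -
    have "e j \<noteq> e l" using that e(2) by (auto dest: inj_onD)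
    then have "card {a. a < q \<and> e j a = e l a} < t" using that e(1) by (intro F(4)) auto
    then show ?thesis using that by (simp add: inner)
  qed
  ultimately show ?thesis by (intro exI[of _ g]) simp
qed

section \<open>Choice of parameters\<close>

lemma two_power_le_fact: "2 ^ n \<le> 2 * (fact n :: nat)"
proof (induction n)
  case (Suc n)
  show ?case
  proof (cases "n = 0")
    case False
    have "2 * 2 ^ n \<le> Suc n * (2 * fact n)"
      using False Suc by (intro mult_le_mono) auto
    then show ?thesis by simp
  qed simp
qed simp

text \<open>With t about k^\<alpha> and q about sqrt k, the ratio has the required order, while t!
  \<ge> 2^(t-1) outgrows every power of k.\<close>

lemma eventually_parameters:
  fixes \<alpha> c :: real
  assumes "0 < \<alpha>" "\<alpha> < 1 / 2"
  shows "\<forall>\<^sub>F k :: nat in sequentially.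
    \<exists>t q. 1 \<le> t \<and> t \<le> q \<and> q * q \<le> k \<and> real k powr c \<le> fact t \<and>
      real k powr (1 / 2 - \<alpha>) / 4 \<le> real q / (2 * real t)"
proof -
  \<comment> \<open>The 2 in the exponent pays for the floor in \<open>t\<close> and for the factor
    2 of \<open>two_power_le_fact\<close>. The 1 in the next estimate pays for the floor in
    \<open>q\<close>, giving t \<le> q. Finally, k \<ge> 4 gives q \<ge> sqrt k / 2, hence the
    constant 4 in the conclusion.\<close>
  have "\<forall>\<^sub>F k :: nat in sequentially. real k powr c \<le> 2 powr (real k powr \<alpha> - 2)"
    using assms by real_asymp
  moreover have "\<forall>\<^sub>F k :: nat in sequentially. real k powr \<alpha> \<le> real k powr (1/2) - 1"
    using assms by real_asymp
  moreover have "\<forall>\<^sub>F k :: nat in sequentially. 4 \<le> k" by (rule eventually_ge_at_top)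
  ultimately show ?thesis
  proof eventually_elim
    case (elim k)
    define t where "t = nat \<lfloor>real k powr \<alpha>\<rfloor>"
    define q where "q = nat \<lfloor>sqrt k\<rfloor>"
    have sqrt: "real k powr (1/2) = sqrt k" by (simp add: powr_half_sqrt)
    have "1 \<le> real k powr \<alpha>" using elim assms by (simp add: ge_one_powr_ge_zero)
    then have t: "1 \<le> t" "real t \<le> real k powr \<alpha>" "real k powr \<alpha> < real t + 1"
      by (auto simp: t_def le_nat_floor)
    have "2 \<le> sqrt k" using elim by (simp add: real_le_rsqrt)
    then have q: "real q \<le> sqrt k" "sqrt k < real q + 1"
      by (auto simp: q_def)
    have "real t \<le> real q" using t q elim sqrt by linarith
    moreover have "q * q \<le> k"
    proof -
      have "real q * real q \<le> sqrt k * sqrt k" using q by (intro mult_mono) auto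
      then show ?thesis by (simp flip: of_nat_mult)
    qed
    moreover have "real k powr c \<le> fact t"
    proof -
      have "real k powr c \<le> 2 powr (real t - 1)"
        by (rule order_trans[OF elim(1)]) (use t(3) in \<open>auto intro: powr_mono\<close>)
      also have "\<dots> = 2 ^ t / 2" by (simp add: powr_diff powr_realpow)
      also have "\<dots> \<le> fact t"
        using of_nat_mono[OF two_power_le_fact[of t], where 'a = real] by simp
      finally show ?thesis .
    qed
    moreover have "real k powr (1 / 2 - \<alpha>) / 4 \<le> real q / (2 * real t)"
    proof -
      have "real k powr (1 / 2 - \<alpha>) / 4 = (sqrt k / 2) / (2 * real k powr \<alpha>)"
        using sqrt by (simp add: powr_diff)
      also have "\<dots> \<le> real q / (2 * real t)"
        using t q \<open>2 \<le> sqrt k\<close> by (intro frac_le) auto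
      finally show ?thesis .
    qed
    ultimately show ?case using t by (intro exI[of _ t] exI[of _ q]) auto
  qed
qed

section \<open>Uniform constant and assembly\<close>

theorem theorem7p7:
  fixes \<alpha> c :: real
  assumes "0 < \<alpha>" and "\<alpha> < 1 / 2" and "1 \<le> c"
  shows "\<exists>C>0. \<forall>k r :: nat. 1 \<le> k \<and> real r = real k powr c \<longrightarrow>
    (\<exists>A \<in> carrier_mat (k + 2 ^ r) r.
      (\<exists>B. is_arg_min (\<lambda>B. max_entry_norm (A - B))
             (\<lambda>B. B \<in> carrier_mat (k + 2 ^ r) r \<and> vec_space.rank (k + 2 ^ r) B \<le> k) B
           \<and> max_entry_norm (A - B) \<le> 1) \<and>
      (\<forall>S. S \<subseteq> {..<r} \<and> real (card S) \<le> real r / 2 \<longrightarrow>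
        (\<exists>X. is_arg_min (\<lambda>X. max_entry_norm (A - column_submatrix A S * X))
               (\<lambda>X. X \<in> carrier_mat (card S) r) X
             \<and> max_entry_norm (A - column_submatrix A S * X) \<ge> C * real k powr (1 / 2 - \<alpha>))))"
proof -
  obtain K where K: "\<And>k. K \<le> k \<Longrightarrow> \<exists>t q. 1 \<le> t \<and> t \<le> q \<and> q * q \<le> k \<and>
      real k powr c \<le> fact t \<and> real k powr (1 / 2 - \<alpha>) / 4 \<le> real q / (2 * real t)"
    using eventually_parameters[OF assms(1,2), of c] unfolding eventually_sequentially by blast
  \<comment> \<open>\<open>C\<close> is at most 1/4, as the asymptotic range requires, and small
    enough that the claimed bound is at most 1 when k < K. There the sign rows alone suffice, with
    \<open>G\<close> zero.\<close>
  define C where "C = 1 / (4 + real K)"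
  have "0 < C" by (simp add: C_def add_pos_nonneg)
  have main: "\<exists>G. \<forall>S j X. S \<subseteq> {..<r} \<longrightarrow> j < r \<longrightarrow> j \<notin> S \<longrightarrow> X \<in> carrier_mat (card S) r \<longrightarrow>
      C * real k powr (1 / 2 - \<alpha>) \<le>
        max_entry_norm (sign_stack k r G - column_submatrix (sign_stack k r G) S * X)"
    if "1 \<le> k" "real r = real k powr c" for k r :: nat
  proof (cases "K \<le> k")
    case True
    then obtain t q where tq: "1 \<le> t" "t \<le> q" "q * q \<le> k" "real k powr c \<le> fact t"
      "real k powr (1 / 2 - \<alpha>) / 4 \<le> real q / (2 * real t)"
      using K by blast
    have "real r \<le> real (fact t)" using tq(4) that(2) by simp
    then have r: "r \<le> fact t" by (simp only: of_nat_le_iff)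
    obtain g :: "nat \<Rightarrow> nat \<Rightarrow> real"
      where g: "\<forall>j<r. (\<Sum>i<k. \<bar>g j i\<bar>) = real q"
        "\<forall>j<r. (\<Sum>i<k. g j i * g j i) = real q"
        "\<forall>j<r. \<forall>l<r. j \<noteq> l \<longrightarrow> \<bar>\<Sum>i<k. g j i * g l i\<bar> \<le> real t"
      using ex_incoherent_vectors[OF tq(1-3) r] by (elim exE conjE)
    have "C \<le> 1 / 4" unfolding C_def by (intro frac_le) auto
    then have "C * real k powr (1 / 2 - \<alpha>) \<le> real k powr (1 / 2 - \<alpha>) / 4"
      using mult_right_mono[of C "1/4" "real k powr (1 / 2 - \<alpha>)"] by simp
    also note tq(5)
    finally have bound: "C * real k powr (1 / 2 - \<alpha>) \<le> real q / (2 * real t)" .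
    show ?thesis
    proof (intro exI[of _ "\<lambda>i j. real q * g j i"] allI impI)
      fix S j and X :: "real mat"
      assume "S \<subseteq> {..<r}" "j < r" "j \<notin> S" "X \<in> carrier_mat (card S) r"
      then show "C * real k powr (1 / 2 - \<alpha>) \<le>
        max_entry_norm (sign_stack k r (\<lambda>i j. real q * g j i) -
          column_submatrix (sign_stack k r (\<lambda>i j. real q * g j i)) S * X)"
        using tq(1,2) by (intro order_trans[OF bound sign_stack_incoherent_error] g[rule_format]) auto
    qed
  next
    case False
    have "real k powr (1 / 2 - \<alpha>) \<le> real k powr 1"
      using that(1) assms by (intro powr_mono) auto
    also have "\<dots> \<le> 4 + real K" using False that(1) by simp
    finally have "C * real k powr (1 / 2 - \<alpha>) \<le> 1"
      by (simp add: C_def divide_le_eq)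
    moreover have "1 \<le> max_entry_norm (sign_stack k r (\<lambda>_ _. 0) -
        column_submatrix (sign_stack k r (\<lambda>_ _. 0)) S * X)"
      if "S \<subseteq> {..<r}" "j < r" "j \<notin> S" "X \<in> carrier_mat (card S) r" for S j X
      using sign_stack_column_error[OF that, of k "\<lambda>_ _. 0"]
        sum_abs_ge_zero[of "\<lambda>l. X $$ (l, j)" "{..<card S}"] by linarith
    ultimately show ?thesis
      by (intro exI[of _ "\<lambda>_ _. 0"] allI impI) (rule order_trans)
  qed
  show ?thesis
  proof (intro exI[of _ C] conjI allI impI \<open>0 < C\<close>)
    fix k r :: nat
    assume kr: "1 \<le> k \<and> real r = real k powr c"
    \<comment> \<open>Since c \<ge> 1, k \<le> r, as \<open>sign_stack_low_rank\<close>
      requires.\<close>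
    have "real k powr 1 \<le> real k powr c"
      using kr assms by (intro powr_mono) auto
    then have "k \<le> r" using kr by simp
    then have "0 < r" using kr by simp
    obtain G where G: "\<And>S j X. S \<subseteq> {..<r} \<Longrightarrow> j < r \<Longrightarrow> j \<notin> S \<Longrightarrow> X \<in> carrier_mat (card S) r \<Longrightarrow>
      C * real k powr (1 / 2 - \<alpha>) \<le>
        max_entry_norm (sign_stack k r G - column_submatrix (sign_stack k r G) S * X)"
      using main[of k r] kr by blast
    show "\<exists>A \<in> carrier_mat (k + 2 ^ r) r.
      (\<exists>B. is_arg_min (\<lambda>B. max_entry_norm (A - B))
             (\<lambda>B. B \<in> carrier_mat (k + 2 ^ r) r \<and> vec_space.rank (k + 2 ^ r) B \<le> k) B
           \<and> max_entry_norm (A - B) \<le> 1) \<and>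
      (\<forall>S. S \<subseteq> {..<r} \<and> real (card S) \<le> real r / 2 \<longrightarrow>
        (\<exists>X. is_arg_min (\<lambda>X. max_entry_norm (A - column_submatrix A S * X))
               (\<lambda>X. X \<in> carrier_mat (card S) r) X
             \<and> max_entry_norm (A - column_submatrix A S * X) \<ge> C * real k powr (1 / 2 - \<alpha>)))"
    proof (intro bexI[of _ "sign_stack k r G"] conjI allI impI sign_stack_carrier
        sign_stack_low_rank \<open>0 < r\<close> \<open>k \<le> r\<close>)
      fix S :: "nat set"
      assume S: "S \<subseteq> {..<r} \<and> real (card S) \<le> real r / 2"
      obtain X where X: "is_arg_min (\<lambda>X. max_entry_norm (sign_stack k r G - column_submatrix (sign_stack k r G) S * X))
               (\<lambda>X. X \<in> carrier_mat (card S) r) X"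
        using sign_stack_ex_best \<open>0 < r\<close> S by blast
      \<comment> \<open>At most half of a positive number of columns leaves some column
        \<open>j\<close> out. The bound from \<open>G\<close> holds for every coefficient matrix, so
        in particular for the minimizer \<open>X\<close>.\<close>
      have "S \<noteq> {..<r}" using S \<open>0 < r\<close> by auto
      then obtain j where "j < r" "j \<notin> S" using S by auto
      then show "\<exists>X. is_arg_min (\<lambda>X. max_entry_norm (sign_stack k r G - column_submatrix (sign_stack k r G) S * X))
               (\<lambda>X. X \<in> carrier_mat (card S) r) X
             \<and> max_entry_norm (sign_stack k r G - column_submatrix (sign_stack k r G) S * X) \<ge> C * real k powr (1 / 2 - \<alpha>)"
        using X G[of S j X] S by (auto simp: is_arg_min_def)
    qed
  qed
qed

end
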